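(* Let $n\ge1$ and let $\alpha,\beta\in\mathcal{ODCT}_n$. On the semigroup $\mathcal{ODCT}_n$: (i) $(\alpha,\beta)\in\mathcal{L}^*$ if and only if $\operatorname{Im}\alpha=\operatorname{Im}\beta$; (ii) $(\alpha,\beta)\in\mathcal{R}^*$ if and only if $\alpha=\beta$; (iii) $\mathcal{H}^*=\mathcal{R}^*$; (iv) $\mathcal{D}^*=\mathcal{L}^*$.
   Context: $[n]=\{1,2,\ldots,n\}$ with its usual order. Maps are written on the right of their arguments. $\mathcal{ODCT}_n$ is the semigroup (under composition, $x(\alpha\beta)=(x\alpha)\beta$) of all maps $\alpha:[n]\to[n]$ that are contractions ($|x\alpha-y\alpha|\le|x-y|$ for all $x,y\in[n]$), order-preserving ($x\le y\Rightarrow x\alpha\le y\alpha$) and order-decreasing ($x\alpha\le x$ for all $x\in[n]$). $\operatorname{Im}\alpha$ is the image of $\alpha$. On a semigroup $S$, the starred Green's relations are (equivalently to being related by $\mathcal{L}$, respectively $\mathcal{R}$, in some oversemigroup of $S$): $\mathcal{L}^*=\{(\alpha,\beta)\in S\times S: \text{for all }\mu,\lambda\in S^1,\ \alpha\mu=\alpha\lambda \iff \beta\mu=\beta\lambda\}$; $\mathcal{R}^*=\{(\alpha,\beta)\in S\times S: \text{for all }\mu,\lambda\in S^1,\ \mu\alpha=\lambda\alpha \iff \mu\beta=\lambda\beta\}$; $\mathcal{H}^*=\mathcal{L}^*\cap\mathcal{R}^*$; and $\mathcal{D}^*$ is the join of $\mathcal{L}^*$ and $\mathcal{R}^*$ (the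 smallest equivalence relation containing both). *)

theory Defs
  imports Main "HOL-Library.FuncSet"
begin

text \<open>
  A semigroup is given by a carrier \<open>S\<close> and a multiplication \<open>m\<close> that is closed
  and associative on \<open>S\<close>. The monoid \<open>S\<^sup>1\<close> is represented inside the option type:
  \<open>Some a\<close> stands for the element \<open>a\<close> of \<open>S\<close>, and \<open>None\<close> for the identity that is
  adjoined exactly when \<open>S\<close> has none of its own.
\<close>

definition has_identity :: "'a set \<Rightarrow> ('a \<Rightarrow> 'a \<Rightarrow> 'a) \<Rightarrow> bool" where
  "has_identity S m \<longleftrightarrow> (\<exists>e\<in>S. \<forall>a\<in>S. m e a = a \<and> m a e = a)"

definition adjoin_one :: "'a set \<Rightarrow> ('a \<Rightarrow> 'a \<Rightarrow> 'a) \<Rightarrow> 'a option set" where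
  "adjoin_one S m = (if has_identity S m then Some ` S else insert None (Some ` S))"

fun mult1 :: "('a \<Rightarrow> 'a \<Rightarrow> 'a) \<Rightarrow> 'a option \<Rightarrow> 'a option \<Rightarrow> 'a option" where
  "mult1 m None b = b"
| "mult1 m (Some a) None = Some a"
| "mult1 m (Some a) (Some b) = Some (m a b)"

definition L_star :: "'a set \<Rightarrow> ('a \<Rightarrow> 'a \<Rightarrow> 'a) \<Rightarrow> ('a \<times> 'a) set" where
  "L_star S m = {(a, b) \<in> S \<times> S. \<forall>\<mu>\<in>adjoin_one S m. \<forall>\<nu>\<in>adjoin_one S m.
     mult1 m (Some a) \<mu> = mult1 m (Some a) \<nu> \<longleftrightarrow> mult1 m (Some b) \<mu> = mult1 m (Some b) \<nu>}"

definition R_star :: "'a set \<Rightarrow> ('a \<Rightarrow> 'a \<Rightarrow> 'a) \<Rightarrow> ('a \<times> 'a) set" where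
  "R_star S m = {(a, b) \<in> S \<times> S. \<forall>\<mu>\<in>adjoin_one S m. \<forall>\<nu>\<in>adjoin_one S m.
     mult1 m \<mu> (Some a) = mult1 m \<nu> (Some a) \<longleftrightarrow> mult1 m \<mu> (Some b) = mult1 m \<nu> (Some b)}"

definition H_star :: "'a set \<Rightarrow> ('a \<Rightarrow> 'a \<Rightarrow> 'a) \<Rightarrow> ('a \<times> 'a) set" where
  "H_star S m = L_star S m \<inter> R_star S m"

definition D_star :: "'a set \<Rightarrow> ('a \<Rightarrow> 'a \<Rightarrow> 'a) \<Rightarrow> ('a \<times> 'a) set" where
  "D_star S m = \<Inter>{r. equiv S r \<and> L_star S m \<union> R_star S m \<subseteq> r}"

text \<open>
  Self-maps of \<open>[n] = {1..n}\<close> are extensional functions (value \<open>undefined\<close> outside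
  \<open>{1..n}\<close>), so that equality of functions is equality of maps on \<open>[n]\<close>.
  The distances are taken in \<open>int\<close> because subtraction on \<open>nat\<close> truncates.
\<close>

definition ODCT :: "nat \<Rightarrow> (nat \<Rightarrow> nat) set" where
  "ODCT n = {\<alpha> \<in> {1..n} \<rightarrow>\<^sub>E {1..n}.
     (\<forall>x\<in>{1..n}. \<forall>y\<in>{1..n}. \<bar>int (\<alpha> x) - int (\<alpha> y)\<bar> \<le> \<bar>int x - int y\<bar>) \<and>
     (\<forall>x\<in>{1..n}. \<forall>y\<in>{1..n}. x \<le> y \<longrightarrow> \<alpha> x \<le> \<alpha> y) \<and>
     (\<forall>x\<in>{1..n}. \<alpha> x \<le> x)}"

text \<open>Maps act on the right: in the product \<open>\<alpha>\<beta>\<close>, the map \<open>\<alpha>\<close> is applied first.\<close>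

definition map_mult :: "nat \<Rightarrow> (nat \<Rightarrow> nat) \<Rightarrow> (nat \<Rightarrow> nat) \<Rightarrow> (nat \<Rightarrow> nat)" where
  "map_mult n \<alpha> \<beta> = compose {1..n} \<beta> \<alpha>"

lemma ODCT_D:
  assumes "\<alpha> \<in> ODCT n" "x \<in> {1..n}"
  shows "\<alpha> x \<in> {1..n}" "\<alpha> x \<le> x"
    "y \<in> {1..n} \<Longrightarrow> \<bar>int (\<alpha> x) - int (\<alpha> y)\<bar> \<le> \<bar>int x - int y\<bar>"
    "y \<in> {1..n} \<Longrightarrow> x \<le> y \<Longrightarrow> \<alpha> x \<le> \<alpha> y"
  using assms PiE_mem[of \<alpha> "{1..n}" "\<lambda>_. {1..n}" x] unfolding ODCT_def by simp_all

lemma map_mult_closed: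
  assumes "\<alpha> \<in> ODCT n" "\<beta> \<in> ODCT n"
  shows "map_mult n \<alpha> \<beta> \<in> ODCT n"
proof -
  note a = ODCT_D[OF assms(1)] and b = ODCT_D[OF assms(2)]
  have "map_mult n \<alpha> \<beta> \<in> {1..n} \<rightarrow>\<^sub>E {1..n}"
    unfolding map_mult_def compose_def by (intro restrict_PiE_iff[THEN iffD2] ballI b(1) a(1))
  moreover have "map_mult n \<alpha> \<beta> x = \<beta> (\<alpha> x)" if "x \<in> {1..n}" for x
    using that unfolding map_mult_def by (rule compose_eq)
  moreover have "\<bar>int (\<beta> (\<alpha> x)) - int (\<beta> (\<alpha> y))\<bar> \<le> \<bar>int x - int y\<bar>"
    if "x \<in> {1..n}" "y \<in> {1..n}" for x y
    using b(3)[OF a(1) a(1), OF that] a(3)[OF that] by (rule order_trans)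
  moreover have "\<beta> (\<alpha> x) \<le> \<beta> (\<alpha> y)" if "x \<in> {1..n}" "y \<in> {1..n}" "x \<le> y" for x y
    by (rule b(4)[OF a(1) a(1) a(4)]) (fact that)+
  moreover have "\<beta> (\<alpha> x) \<le> x" if "x \<in> {1..n}" for x
    using b(2)[OF a(1)[OF that]] a(2)[OF that] by (rule order_trans)
  ultimately show ?thesis
    unfolding ODCT_def by (simp del: atLeastAtMost_iff)
qed

lemma map_mult_assoc:
  assumes "\<alpha> \<in> ODCT n"
  shows "map_mult n (map_mult n \<alpha> \<beta>) \<gamma> = map_mult n \<alpha> (map_mult n \<beta> \<gamma>)"
proof -
  have "\<alpha> \<in> {1..n} \<rightarrow> {1..n}"
    using assms unfolding ODCT_def by blast
  then show ?thesis
    unfolding map_mult_def by (rule compose_assoc)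
qed

end

theory Submission
  imports Defs
begin

text \<open>
  The monoid \<open>ODCT n\<close> contains the truncations \<open>x \<mapsto> min x k\<close> for \<open>1 \<le> k\<close>, the identity being
  the truncation at \<open>n\<close>, and these maps test everything that is needed.

  An element \<open>\<alpha>\<close> climbs from \<open>\<alpha> 1 = 1\<close> in steps of \<open>0\<close> or \<open>1\<close>. Hence its image is the interval
  \<open>{1..\<alpha> n}\<close> (\<open>ODCT_image\<close>), and \<open>\<alpha>\<close> is determined by the set of places where the step is
  \<open>0\<close> (\<open>ODCT_eqI\<close>).

  For \<open>\<L>\<^sup>*\<close>: right multiples \<open>\<alpha>\<mu>\<close>, \<open>\<alpha>\<nu>\<close> agree iff \<open>\<mu>\<close>, \<open>\<nu>\<close> agree on the image of \<open>\<alpha>\<close>, so equal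
  images give \<open>\<L>\<^sup>*\<close>-related maps. Conversely, composing \<open>\<alpha>\<close> with the truncation at \<open>k\<close> gives back
  \<open>\<alpha>\<close> iff \<open>\<alpha> n \<le> k\<close>, so \<open>\<L>\<^sup>*\<close>-related maps have the same last value, hence the same image.

  For \<open>\<R>\<^sup>*\<close>: the truncations at \<open>x\<close> and at \<open>x + 1\<close> have the same product with \<open>\<alpha>\<close> iff \<open>\<alpha>\<close> has
  step \<open>0\<close> at \<open>x\<close>, so \<open>\<R>\<^sup>*\<close>-related maps have the same steps and are equal.

  Thus \<open>\<R>\<^sup>*\<close> is equality on \<open>ODCT n\<close>, the least of all reflexive relations, and the statements on
  \<open>\<H>\<^sup>*\<close> and \<open>\<D>\<^sup>*\<close> follow because \<open>\<L>\<^sup>*\<close> is an equivalence relation.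
\<close>

section \<open>Starred relations in a semigroup\<close>

lemma equiv_L_star: "equiv S (L_star S m)"
  unfolding equiv_def refl_on_def sym_def trans_def L_star_def by auto

lemma refl_on_R_star: "refl_on S (R_star S m)"
  unfolding refl_on_def R_star_def by auto

lemma D_star_eq_L_star:
  assumes "R_star S m \<subseteq> L_star S m"
  shows "D_star S m = L_star S m"
  using assms equiv_L_star[of S m] unfolding D_star_def by blast

lemma L_star_iff_if_has_identity:
  assumes "has_identity S m"
  shows "(a, b) \<in> L_star S m \<longleftrightarrow>
    a \<in> S \<and> b \<in> S \<and> (\<forall>u\<in>S. \<forall>v\<in>S. m a u = m a v \<longleftrightarrow> m b u = m b v)"
  using assms unfolding L_star_def adjoin_one_def by simp

lemma R_star_iff_if_has_identity:
  assumes "has_identity S m"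
  shows "(a, b) \<in> R_star S m \<longleftrightarrow>
    a \<in> S \<and> b \<in> S \<and> (\<forall>u\<in>S. \<forall>v\<in>S. m u a = m v a \<longleftrightarrow> m u b = m v b)"
  using assms unfolding R_star_def adjoin_one_def by simp

section \<open>Steps and images of order-preserving, order-decreasing contractions\<close>

lemma ODCT_first:
  assumes "\<alpha> \<in> ODCT n" "1 \<le> n"
  shows "\<alpha> 1 = 1"
  using ODCT_D(1,2)[OF assms(1), of 1] assms(2) by simp

lemma ODCT_step:
  assumes "\<alpha> \<in> ODCT n" "x \<in> {1..n}" "Suc x \<in> {1..n}"
  shows "\<alpha> (Suc x) = \<alpha> x \<or> \<alpha> (Suc x) = Suc (\<alpha> x)"
  using ODCT_D(3,4)[OF assms] by auto

text \<open>The initial value and all steps are forced: each step is \<open>0\<close> or \<open>1\<close>.\<close>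

lemma ODCT_eqI:
  assumes \<alpha>: "\<alpha> \<in> ODCT n" and \<beta>: "\<beta> \<in> ODCT n"
    and flat: "\<And>x. x \<in> {1..n} \<Longrightarrow> Suc x \<in> {1..n} \<Longrightarrow> \<alpha> (Suc x) = \<alpha> x \<longleftrightarrow> \<beta> (Suc x) = \<beta> x"
  shows "\<alpha> = \<beta>"
proof (rule PiE_ext)
  show "\<alpha> \<in> {1..n} \<rightarrow>\<^sub>E {1..n}" "\<beta> \<in> {1..n} \<rightarrow>\<^sub>E {1..n}"
    using \<alpha> \<beta> by (simp_all only: ODCT_def mem_Collect_eq)
  show "\<alpha> x = \<beta> x" if "x \<in> {1..n}" for x
  proof -
    have "1 \<le> x" "x \<le> n"
      using that by auto
    then show ?thesis
    proof (induction x rule: dec_induct)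
      case base
      then show ?case
        using ODCT_first[OF \<alpha>] ODCT_first[OF \<beta>] by simp
    next
      case (step x)
      then have x: "x \<in> {1..n}" "Suc x \<in> {1..n}" and eq: "\<alpha> x = \<beta> x"
        by auto
      show ?case
        using ODCT_step[OF \<alpha> x] ODCT_step[OF \<beta> x] flat[OF x] eq by auto
    qed
  qed
qed

text \<open>A discrete intermediate value argument: a map with steps at most \<open>1\<close> cannot skip a value.\<close>

lemma ODCT_image:
  assumes \<alpha>: "\<alpha> \<in> ODCT n" and "1 \<le> n"
  shows "\<alpha> ` {1..n} = {1..\<alpha> n}"
proof
  show "\<alpha> ` {1..n} \<subseteq> {1..\<alpha> n}"
    using ODCT_D(1,4)[OF \<alpha>] \<open>1 \<le> n\<close> by fastforce
  have "{1..\<alpha> k} \<subseteq> \<alpha> ` {1..k}" if "1 \<le> k" "k \<le> n" for k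
    using that
  proof (induction k rule: dec_induct)
    case base
    then show ?case
      using ODCT_first[OF \<alpha>] by simp
  next
    case (step k)
    then have IH: "{1..\<alpha> k} \<subseteq> \<alpha> ` {1..k}" and k: "k \<in> {1..n}" "Suc k \<in> {1..n}"
      by auto
    have "{1..\<alpha> (Suc k)} \<subseteq> insert (\<alpha> (Suc k)) {1..\<alpha> k}"
      using ODCT_step[OF \<alpha> k] by auto
    also have "\<dots> \<subseteq> insert (\<alpha> (Suc k)) (\<alpha> ` {1..k})"
      using IH by blast
    also have "\<dots> = \<alpha> ` {1..Suc k}"
      by (simp add: atLeastAtMostSuc_conv)
    finally show ?case .
  qed
  then show "{1..\<alpha> n} \<subseteq> \<alpha> ` {1..n}"
    using \<open>1 \<le> n\<close> by blast
qed

section \<open>Products and truncations\<close>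

lemma map_mult_eq_iff:
  "map_mult n \<alpha> \<beta> = map_mult n \<gamma> \<delta> \<longleftrightarrow> (\<forall>x\<in>{1..n}. \<beta> (\<alpha> x) = \<delta> (\<gamma> x))"
  unfolding map_mult_def compose_def by (auto simp: fun_eq_iff restrict_def)

definition truncation :: "nat \<Rightarrow> nat \<Rightarrow> nat \<Rightarrow> nat" where
  "truncation n k = (\<lambda>x\<in>{1..n}. min x k)"

lemma truncation_apply: "x \<in> {1..n} \<Longrightarrow> truncation n k x = min x k"
  by (simp add: truncation_def)

lemma truncation_in_ODCT:
  assumes "1 \<le> k"
  shows "truncation n k \<in> ODCT n"
  using assms unfolding ODCT_def truncation_def by auto

lemma has_identity_ODCT:
  assumes "1 \<le> n"
  shows "has_identity (ODCT n) (map_mult n)"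
  unfolding has_identity_def
proof (intro bexI[of _ "truncation n n"] ballI conjI)
  show "truncation n n \<in> ODCT n"
    using assms by (rule truncation_in_ODCT)
  fix \<alpha> assume \<alpha>: "\<alpha> \<in> ODCT n"
  then have ext: "\<alpha> \<in> extensional {1..n}"
    unfolding ODCT_def PiE_def by blast
  show "map_mult n (truncation n n) \<alpha> = \<alpha>"
    unfolding map_mult_def
    by (rule extensionalityI[OF compose_extensional ext]) (simp add: compose_eq truncation_apply)
  show "map_mult n \<alpha> (truncation n n) = \<alpha>"
    unfolding map_mult_def
    using ODCT_D(1)[OF \<alpha>]
    by (intro extensionalityI[OF compose_extensional ext]) (simp add: compose_eq truncation_apply)
qed

section \<open>The starred relations of the monoid\<close>

text \<open>
  Truncating at \<open>\<alpha> n\<close> and truncating at \<open>n\<close> agree after \<open>\<alpha>\<close>, hence after \<open>\<beta>\<close>, so \<open>\<beta>\<close> has no value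
  above \<open>\<alpha> n\<close>.
\<close>

lemma L_star_last_le:
  assumes "1 \<le> n" and L: "(\<alpha>, \<beta>) \<in> L_star (ODCT n) (map_mult n)"
  shows "\<beta> n \<le> \<alpha> n"
proof -
  note iff = L_star_iff_if_has_identity[OF has_identity_ODCT[OF \<open>1 \<le> n\<close>]]
  have \<alpha>: "\<alpha> \<in> ODCT n" and \<beta>: "\<beta> \<in> ODCT n"
    using L by (auto simp: iff)
  have n: "n \<in> {1..n}"
    using \<open>1 \<le> n\<close> by simp
  have "1 \<le> \<alpha> n"
    using ODCT_D(1)[OF \<alpha> n] by simp
  have "map_mult n \<alpha> (truncation n (\<alpha> n)) = map_mult n \<alpha> (truncation n n)"
    unfolding map_mult_eq_iff
  proof
    fix x assume x: "x \<in> {1..n}"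
    then have "\<alpha> x \<le> \<alpha> n"
      using ODCT_D(4)[OF \<alpha> x n] by simp
    then show "truncation n (\<alpha> n) (\<alpha> x) = truncation n n (\<alpha> x)"
      using ODCT_D(1)[OF \<alpha> x] by (simp add: truncation_apply)
  qed
  then have "map_mult n \<beta> (truncation n (\<alpha> n)) = map_mult n \<beta> (truncation n n)"
    using L truncation_in_ODCT[OF \<open>1 \<le> \<alpha> n\<close>] truncation_in_ODCT[OF \<open>1 \<le> n\<close>]
    unfolding iff by blast
  then have "truncation n (\<alpha> n) (\<beta> n) = truncation n n (\<beta> n)"
    using n unfolding map_mult_eq_iff by blast
  then show ?thesis
    using ODCT_D(1)[OF \<beta> n] by (simp add: truncation_apply)
qed

lemma L_star_ODCT_iff:
  assumes "1 \<le> n" and \<alpha>: "\<alpha> \<in> ODCT n" and \<beta>: "\<beta> \<in> ODCT n"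
  shows "(\<alpha>, \<beta>) \<in> L_star (ODCT n) (map_mult n) \<longleftrightarrow> \<alpha> ` {1..n} = \<beta> ` {1..n}"
proof
  assume L: "(\<alpha>, \<beta>) \<in> L_star (ODCT n) (map_mult n)"
  then have "(\<beta>, \<alpha>) \<in> L_star (ODCT n) (map_mult n)"
    using equiv_L_star by (metis equivE symD)
  then have "\<alpha> n = \<beta> n"
    using L L_star_last_le[OF \<open>1 \<le> n\<close>] by (metis le_antisym)
  then show "\<alpha> ` {1..n} = \<beta> ` {1..n}"
    using ODCT_image \<alpha> \<beta> \<open>1 \<le> n\<close> by metis
next
  assume im: "\<alpha> ` {1..n} = \<beta> ` {1..n}"
  have "map_mult n \<gamma> \<mu> = map_mult n \<gamma> \<nu> \<longleftrightarrow> (\<forall>y\<in>\<gamma> ` {1..n}. \<mu> y = \<nu> y)" for \<gamma> \<mu> \<nu>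
    unfolding map_mult_eq_iff by blast
  with im have "map_mult n \<alpha> \<mu> = map_mult n \<alpha> \<nu> \<longleftrightarrow> map_mult n \<beta> \<mu> = map_mult n \<beta> \<nu>" for \<mu> \<nu>
    by (simp only:)
  then show "(\<alpha>, \<beta>) \<in> L_star (ODCT n) (map_mult n)"
    using \<alpha> \<beta> L_star_iff_if_has_identity[OF has_identity_ODCT[OF \<open>1 \<le> n\<close>]] by blast
qed

text \<open>
  The truncations at \<open>x\<close> and \<open>x + 1\<close> differ exactly on the points above \<open>x\<close>, which they send to
  \<open>x\<close> and \<open>x + 1\<close> respectively.
\<close>

lemma truncation_mult_eq_iff:
  assumes "x \<in> {1..n}" "Suc x \<in> {1..n}"
  shows "map_mult n (truncation n (Suc x)) \<alpha> = map_mult n (truncation n x) \<alpha> \<longleftrightarrow> \<alpha> (Suc x) = \<alpha> x"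
proof
  assume "map_mult n (truncation n (Suc x)) \<alpha> = map_mult n (truncation n x) \<alpha>"
  then have "\<alpha> (truncation n (Suc x) (Suc x)) = \<alpha> (truncation n x (Suc x))"
    using assms(2) unfolding map_mult_eq_iff by blast
  then show "\<alpha> (Suc x) = \<alpha> x"
    using assms(2) by (simp add: truncation_apply)
next
  assume eq: "\<alpha> (Suc x) = \<alpha> x"
  have "\<alpha> (min y (Suc x)) = \<alpha> (min y x)" for y
    by (cases "y \<le> x") (auto simp: eq min_def le_Suc_eq)
  then show "map_mult n (truncation n (Suc x)) \<alpha> = map_mult n (truncation n x) \<alpha>"
    unfolding map_mult_eq_iff by (simp add: truncation_apply)
qed

lemma R_star_ODCT_iff:
  assumes "1 \<le> n" and \<alpha>: "\<alpha> \<in> ODCT n" and \<beta>: "\<beta> \<in> ODCT n"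
  shows "(\<alpha>, \<beta>) \<in> R_star (ODCT n) (map_mult n) \<longleftrightarrow> \<alpha> = \<beta>"
proof
  assume R: "(\<alpha>, \<beta>) \<in> R_star (ODCT n) (map_mult n)"
  show "\<alpha> = \<beta>"
  proof (rule ODCT_eqI[OF \<alpha> \<beta>])
    fix x assume x: "x \<in> {1..n}" "Suc x \<in> {1..n}"
    have "truncation n (Suc x) \<in> ODCT n" "truncation n x \<in> ODCT n"
      using x by (auto intro!: truncation_in_ODCT)
    then show "\<alpha> (Suc x) = \<alpha> x \<longleftrightarrow> \<beta> (Suc x) = \<beta> x"
      using R R_star_iff_if_has_identity[OF has_identity_ODCT[OF \<open>1 \<le> n\<close>]]
        truncation_mult_eq_iff[OF x] by blast
  qed
next
  assume "\<alpha> = \<beta>"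
  then show "(\<alpha>, \<beta>) \<in> R_star (ODCT n) (map_mult n)"
    using \<alpha> by (simp add: refl_onD[OF refl_on_R_star])
qed

theorem theorem6:
  fixes n :: nat
  assumes "n \<ge> 1"
  shows "(\<forall>\<alpha>\<in>ODCT n. \<forall>\<beta>\<in>ODCT n.
            (\<alpha>, \<beta>) \<in> L_star (ODCT n) (map_mult n) \<longleftrightarrow> \<alpha> ` {1..n} = \<beta> ` {1..n}) \<and>
         (\<forall>\<alpha>\<in>ODCT n. \<forall>\<beta>\<in>ODCT n.
            (\<alpha>, \<beta>) \<in> R_star (ODCT n) (map_mult n) \<longleftrightarrow> \<alpha> = \<beta>) \<and>
         H_star (ODCT n) (map_mult n) = R_star (ODCT n) (map_mult n) \<and>
         D_star (ODCT n) (map_mult n) = L_star (ODCT n) (map_mult n)"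
proof -
  have sub: "R_star (ODCT n) (map_mult n) \<subseteq> L_star (ODCT n) (map_mult n)"
  proof (rule subrelI)
    fix \<alpha> \<beta> assume R: "(\<alpha>, \<beta>) \<in> R_star (ODCT n) (map_mult n)"
    then have \<alpha>: "\<alpha> \<in> ODCT n" and \<beta>: "\<beta> \<in> ODCT n"
      unfolding R_star_def by auto
    have "\<alpha> = \<beta>"
      using R R_star_ODCT_iff[OF assms \<alpha> \<beta>] by simp
    then show "(\<alpha>, \<beta>) \<in> L_star (ODCT n) (map_mult n)"
      using L_star_ODCT_iff[OF assms \<alpha> \<beta>] by simp
  qed
  have "H_star (ODCT n) (map_mult n) = R_star (ODCT n) (map_mult n)"
    unfolding H_star_def using sub by (rule Int_absorb1)
  then show ?thesis
    using D_star_eq_L_star[OF sub] L_star_ODCT_iff[OF assms] R_star_ODCT_iff[OF assms]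
    by (intro conjI ballI)
qed

end
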